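(* Let $K>0$, $\gamma>1$, and let $(h_{ab})_{a,b=1,2,3}$ be a symmetric positive definite real matrix. Consider the map $$\Phi\begin{pmatrix} w\\ \bar u^a\end{pmatrix}=\begin{pmatrix} w\,\bigl[1+(1+Kw^2)h_{bc}\bar u^b\bar u^c\bigr]^{\frac{\gamma-1}{2}}\\[2mm] \dfrac{(1+Kw^2)\,\bar u^a\sqrt{1+h_{bc}\bar u^b\bar u^c}}{1+(1+Kw^2)h_{bc}\bar u^b\bar u^c}\end{pmatrix}=\begin{pmatrix} y\\ v^a\end{pmatrix}.$$ There is a function $s:[0,1)\to\mathbb R$ such that $\Phi$ is a diffeomorphism from $[0,(\gamma K)^{-1/2})\times\mathbb R^3$ onto $$\Omega=\Bigl\{(y,v^a)\in\mathbb R\times\mathbb R^3:\ 0\le y<s\bigl(\sqrt{h_{ab}v^av^b}\bigr),\ h_{ab}v^av^b<1\Bigr\}.$$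
   Context: Summation over repeated indices is understood. In the underlying problem, $p=K\epsilon^\gamma$ is the equation of state, $w=\epsilon^{(\gamma-1)/2}$, $y=z^{(\gamma-1)/2}$, $v^a=j^a/z$, where $z=\epsilon+(\epsilon+p)h_{ab}\bar u^a\bar u^b$ and $j^a=(\epsilon+p)\bar u^a\sqrt{1+h_{bc}\bar u^b\bar u^c}$; the restriction on $w$ is the causality condition $\partial p/\partial\epsilon=\gamma K w^2<1$. *)

theory Defs
  imports "HOL-Analysis.Analysis"
begin

text \<open>
  \<open>C_k_on k f U\<close> is meant for open \<open>U\<close>. In finite dimensions, \<open>f\<close> is of class \<open>C\<^sup>k\<^sup>+\<^sup>1\<close> on \<open>U\<close> iff it is
  differentiable there and each directional derivative is of class \<open>C\<^sup>k\<close>; iterating directional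
  derivatives keeps the function type fixed.
\<close>

primrec C_k_on ::
  "nat \<Rightarrow> ('a::euclidean_space \<Rightarrow> 'b::euclidean_space) \<Rightarrow> 'a set \<Rightarrow> bool" where
  "C_k_on 0 f U \<longleftrightarrow> continuous_on U f"
| "C_k_on (Suc k) f U \<longleftrightarrow>
     f differentiable_on U \<and> (\<forall>v. C_k_on k (\<lambda>x. frechet_derivative f (at x) v) U)"

text \<open>
  Smoothness on an arbitrary subset of a Euclidean space, in the usual sense for maps between
  subsets (in particular manifolds with boundary): local existence of smooth extensions to
  open sets.
\<close>

definition smooth_on ::
  "('a::euclidean_space \<Rightarrow> 'b::euclidean_space) \<Rightarrow> 'a set \<Rightarrow> bool" where
  "smooth_on f S \<longleftrightarrow>
     (\<forall>x\<in>S. \<exists>U g. open U \<and> x \<in> U \<and> (\<forall>k. C_k_on k g U) \<and> (\<forall>z\<in>S \<inter> U. g z = f z))"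

definition diffeomorphism_onto ::
  "('a::euclidean_space \<Rightarrow> 'b::euclidean_space) \<Rightarrow> 'a set \<Rightarrow> 'b set \<Rightarrow> bool" where
  "diffeomorphism_onto f S T \<longleftrightarrow>
     bij_betw f S T \<and> smooth_on f S \<and> smooth_on (inv_into S f) T"

text \<open>\<open>h_sq h u\<close> is \<open>h\<^sub>a\<^sub>b u\<^sup>a u\<^sup>b\<close>.\<close>

definition h_sq :: "real^3^3 \<Rightarrow> real^3 \<Rightarrow> real" where
  "h_sq h u = (\<Sum>a\<in>UNIV. \<Sum>b\<in>UNIV. h $ a $ b * u $ a * u $ b)"

definition Phi :: "real \<Rightarrow> real \<Rightarrow> real^3^3 \<Rightarrow> real \<times> (real^3) \<Rightarrow> real \<times> (real^3)" where
  "Phi K \<gamma> h = (\<lambda>(w, u).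
     (w * (1 + (1 + K * w\<^sup>2) * h_sq h u) powr ((\<gamma> - 1) / 2),
      \<chi> a. (1 + K * w\<^sup>2) * u $ a * sqrt (1 + h_sq h u) / (1 + (1 + K * w\<^sup>2) * h_sq h u)))"

text \<open>Only the values of \<open>s\<close> on \<open>[0,1)\<close> matter here when \<open>h\<close> is positive definite.\<close>

definition Omega :: "real^3^3 \<Rightarrow> (real \<Rightarrow> real) \<Rightarrow> (real \<times> (real^3)) set" where
  "Omega h s = {(y, v). 0 \<le> y \<and> y < s (sqrt (h_sq h v)) \<and> h_sq h v < 1}"

end

theory Submission
  imports Defs
begin

text \<open>
  Write \<open>k = K w\<^sup>2\<close> and \<open>t = 1 / (1 + (1 + k) |u|\<^sup>2)\<close>. Then \<open>k = K y\<^sup>2 t\<^bsup>\<gamma>-1\<^esup>\<close> and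
  \<open>1 - |v|\<^sup>2 = t - k t (1 - t)\<close>, while conversely \<open>w = y t\<^bsup>(\<gamma>-1)/2\<^esup>\<close> and
  \<open>u = v / sqrt (t (1 + k) (1 + k t))\<close>. So inverting \<open>\<Phi>\<close> amounts to solving the scalar equation
  \<open>t - K y\<^sup>2 t\<^sup>\<gamma> (1 - t) = 1 - |v|\<^sup>2\<close> for \<open>t\<close>. The \<open>t\<close>-derivative of its left-hand side is
  \<open>1 - \<gamma> k + (\<gamma> + 1) k t\<close>, which is positive by the causality condition
  \<open>\<gamma> k < 1\<close>; hence \<open>t\<close> is unique and depends smoothly on \<open>(y, v)\<close>. As \<open>y\<close> enters only through
  \<open>y\<^sup>2\<close>, the inverse extends smoothly across \<open>y = 0\<close>. The boundary function \<open>s\<close> is obtained from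
  the limiting case \<open>\<gamma> k = 1\<close>, in which the equation for \<open>t\<close> is quadratic.
\<close>

section \<open>Calculus of C^k maps on open sets\<close>

lemma C_k_on_has_derivative:
  assumes "C_k_on (Suc k) f U" "open U" "x \<in> U"
  shows "(f has_derivative frechet_derivative f (at x)) (at x)"
  using assms by (simp add: differentiable_on_eq_differentiable_at frechet_derivative_works)

lemma C_k_on_cong:
  assumes "open U" "\<And>x. x \<in> U \<Longrightarrow> f x = g x" "C_k_on k f U"
  shows "C_k_on k g U"
  using assms(2,3)
proof (induction k arbitrary: f g)
  case 0
  then show ?case using continuous_on_cong by fastforce
next
  case (Suc k)
  have der: "(g has_derivative frechet_derivative f (at x)) (at x)" if "x \<in> U" for x
    using C_k_on_has_derivative[OF Suc.prems(2) assms(1) that]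
    by (rule has_derivative_transform_within_open) (use assms(1) that Suc.prems(1) in auto)
  then have "g differentiable_on U"
    using assms(1) by (auto simp: differentiable_on_eq_differentiable_at differentiable_def)
  moreover have "C_k_on k (\<lambda>x. frechet_derivative g (at x) v) U" for v
  proof (rule Suc.IH)
    show "C_k_on k (\<lambda>x. frechet_derivative f (at x) v) U"
      using Suc.prems(2) by simp
    show "frechet_derivative f (at x) v = frechet_derivative g (at x) v" if "x \<in> U" for x
      using frechet_derivative_at[OF der[OF that]] by simp
  qed
  ultimately show ?case by simp
qed

text \<open>\<open>frechet_derivative\<close> is a choice term; uniqueness of derivatives lets an
  explicit \<open>f'\<close> take its place. The derivative formulas below enter through this
  rule.\<close>

lemma C_k_on_SucI:
  assumes "open U"
    and "\<And>x. x \<in> U \<Longrightarrow> (f has_derivative f' x) (at x)"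
    and "\<And>v. C_k_on k (\<lambda>x. f' x v) U"
  shows "C_k_on (Suc k) f U"
proof -
  have "f' x v = frechet_derivative f (at x) v" if "x \<in> U" for x v
    using frechet_derivative_at[OF assms(2)[OF that]] by simp
  then have "C_k_on k (\<lambda>x. frechet_derivative f (at x) v) U" for v
    by (rule C_k_on_cong[OF assms(1) _ assms(3)])
  moreover have "f differentiable_on U"
    using assms(1,2) by (auto simp: differentiable_on_eq_differentiable_at differentiable_def)
  ultimately show ?thesis by simp
qed

lemma C_k_on_SucD: "C_k_on (Suc k) f U \<Longrightarrow> C_k_on k f U"
proof (induction k arbitrary: f)
  case 0
  then show ?case by (simp add: differentiable_imp_continuous_on)
next
  case (Suc k)
  have "f differentiable_on U" "C_k_on (Suc k) (\<lambda>x. frechet_derivative f (at x) v) U" for v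
    using Suc.prems by simp_all
  with Suc.IH show ?case unfolding C_k_on.simps(2)[of k f] by blast
qed

lemma C_k_on_const: "open U \<Longrightarrow> C_k_on k (\<lambda>x. c) U"
proof (induction k arbitrary: c)
  case (Suc k)
  then show ?case
    by (intro C_k_on_SucI[where f' = "\<lambda>x v. 0"]) auto
qed auto

lemma C_k_on_linear:
  assumes "bounded_linear f" "open U"
  shows "C_k_on k f U"
proof (cases k)
  case 0
  then show ?thesis using assms by (simp add: linear_continuous_on)
next
  case (Suc n)
  show ?thesis unfolding Suc
    by (intro C_k_on_SucI[where f' = "\<lambda>x. f"] C_k_on_const)
      (use assms in \<open>auto intro: bounded_linear_imp_has_derivative\<close>)
qed

lemma C_k_on_add:
  assumes "open U"
  shows "C_k_on k f U \<Longrightarrow> C_k_on k g U \<Longrightarrow> C_k_on k (\<lambda>x. f x + g x) U"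
proof (induction k arbitrary: f g)
  case 0
  then show ?case by (auto intro: continuous_on_add)
next
  case (Suc k)
  show ?case
    by (rule C_k_on_SucI
        [where f' = "\<lambda>x v. frechet_derivative f (at x) v + frechet_derivative g (at x) v"])
      (use Suc assms in \<open>auto intro!: derivative_intros
        C_k_on_has_derivative[OF Suc.prems(1)] C_k_on_has_derivative[OF Suc.prems(2)]\<close>)
qed

text \<open>The product rule pairs each function with the derivative of the other, so the induction
  ranges over both functions and also needs each of them at the lower order.\<close>

lemma C_k_on_bilinear:
  assumes "bounded_bilinear pr" "open U"
  shows "C_k_on k f U \<Longrightarrow> C_k_on k g U \<Longrightarrow> C_k_on k (\<lambda>x. pr (f x) (g x)) U"
proof (induction k arbitrary: f g)
  case 0
  then show ?case using assms(1) by (auto intro: bounded_bilinear.continuous_on)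
next
  case (Suc k)
  have "C_k_on k f U" "C_k_on k g U"
    using C_k_on_SucD[OF Suc.prems(1)] C_k_on_SucD[OF Suc.prems(2)] .
  moreover have "C_k_on k (\<lambda>x. frechet_derivative f (at x) v) U"
    "C_k_on k (\<lambda>x. frechet_derivative g (at x) v) U" for v
    using Suc.prems by auto
  ultimately have "C_k_on k (\<lambda>x. pr (f x) (frechet_derivative g (at x) v)
      + pr (frechet_derivative f (at x) v) (g x)) U" for v
    by (intro C_k_on_add assms(2) Suc.IH)
  moreover have "((\<lambda>x. pr (f x) (g x)) has_derivative
      (\<lambda>v. pr (f x) (frechet_derivative g (at x) v)
      + pr (frechet_derivative f (at x) v) (g x))) (at x)" if "x \<in> U" for x
    by (intro bounded_bilinear.FDERIV[OF assms(1)]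
        C_k_on_has_derivative[OF Suc.prems(1) assms(2) that]
        C_k_on_has_derivative[OF Suc.prems(2) assms(2) that])
  ultimately show ?case
    by (intro C_k_on_SucI[OF assms(2)])
qed

lemmas C_k_on_mult = C_k_on_bilinear[OF bounded_bilinear_mult]
lemmas C_k_on_scaleR = C_k_on_bilinear[OF bounded_bilinear_scaleR]

lemma C_k_on_linear_comp:
  assumes "bounded_linear L" "open U"
  shows "C_k_on k f U \<Longrightarrow> C_k_on k (\<lambda>x. L (f x)) U"
proof (induction k arbitrary: f)
  case 0
  then show ?case using assms(1) by (auto intro: bounded_linear.continuous_on)
next
  case (Suc k)
  show ?case
    by (rule C_k_on_SucI[where f' = "\<lambda>x v. L (frechet_derivative f (at x) v)"])
      (use Suc assms in \<open>auto intro!: bounded_linear.has_derivative[OF assms(1)]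
        C_k_on_has_derivative[OF Suc.prems(1)]\<close>)
qed

lemma C_k_on_diff:
  fixes f g :: "'a::euclidean_space \<Rightarrow> 'b::euclidean_space"
  assumes "open U" "C_k_on k f U" "C_k_on k g U"
  shows "C_k_on k (\<lambda>x. f x - g x) U"
  using C_k_on_add[OF assms(1,2) C_k_on_linear_comp[OF bounded_linear_minus[OF bounded_linear_ident] assms(1,3)]]
  by simp

lemma C_k_on_Pair:
  assumes "open U" "C_k_on k f U" "C_k_on k g U"
  shows "C_k_on k (\<lambda>x. (f x, g x)) U"
proof -
  have "bounded_linear (\<lambda>a::'b. (a, 0::'c))" "bounded_linear (\<lambda>b::'c. (0::'b, b))"
    by (intro bounded_linear_Pair bounded_linear_ident bounded_linear_zero)+
  then have "C_k_on k (\<lambda>x. (f x, 0) + (0, g x)) U"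
    by (intro C_k_on_add C_k_on_linear_comp[where L = "\<lambda>a. (a, 0)"]
        C_k_on_linear_comp[where L = "Pair 0"] assms)
  then show ?thesis by simp
qed

lemma C_k_on_sum:
  assumes "open U"
  shows "(\<And>i. i \<in> I \<Longrightarrow> C_k_on k (f i) U) \<Longrightarrow> C_k_on k (\<lambda>x. \<Sum>i\<in>I. f i x) U"
  by (induction I rule: infinite_finite_induct)
    (auto intro: C_k_on_const[OF assms] C_k_on_add[OF assms])

lemma C_k_on_power:
  fixes f :: "'a::euclidean_space \<Rightarrow> real"
  assumes "open U" "C_k_on k f U"
  shows "C_k_on k (\<lambda>x. f x ^ n) U"
  by (induction n) (auto intro: C_k_on_const C_k_on_mult assms)

text \<open>Differentiation lowers the exponent by one, hence the induction over arbitrary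
  \<open>p\<close>. Reciprocals and square roots are the exponents -1 and 1/2.\<close>

lemma C_k_on_powr:
  fixes f :: "'a::euclidean_space \<Rightarrow> real"
  assumes "open U" "\<And>x. x \<in> U \<Longrightarrow> f x > 0"
  shows "C_k_on k f U \<Longrightarrow> C_k_on k (\<lambda>x. f x powr p) U"
proof (induction k arbitrary: p)
  case 0
  then show ?case using assms(2) by (force intro!: continuous_on_powr' continuous_intros)
next
  case (Suc k)
  have "((\<lambda>x. f x powr p) has_derivative
      (\<lambda>v. p * (f x powr (p - 1) * frechet_derivative f (at x) v))) (at x)" if "x \<in> U" for x
    using has_derivative_powr[OF C_k_on_has_derivative[OF Suc.prems assms(1) that]
        has_derivative_const[of p] assms(2)[OF that]] assms(2)[OF that]
    by (simp add: algebra_simps powr_diff divide_simps)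
  moreover have "C_k_on k (\<lambda>x. p * (f x powr (p - 1) * frechet_derivative f (at x) v)) U" for v
    using Suc.prems C_k_on_SucD[OF Suc.prems]
    by (intro C_k_on_mult C_k_on_const Suc.IH assms(1)) auto
  ultimately show ?case
    by (intro C_k_on_SucI[OF assms(1)])
qed

text \<open>In the chain rule the direction in which \<open>f\<close> is differentiated varies with
  the point, whereas \<open>C_k_on\<close> speaks of fixed directions. Expanding it in the basis
  leaves fixed directions \<open>b\<close> with C^k coefficients.\<close>

lemma C_k_on_compose:
  assumes "open U" "open V"
  shows "C_k_on k f V \<Longrightarrow> C_k_on k g U \<Longrightarrow> g ` U \<subseteq> V \<Longrightarrow> C_k_on k (\<lambda>x. f (g x)) U"
proof (induction k arbitrary: f)
  case 0
  then show ?case by (auto intro: continuous_on_compose2)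
next
  case (Suc k)
  let ?f' = "\<lambda>x v. \<Sum>b\<in>Basis. (frechet_derivative g (at x) v \<bullet> b) *\<^sub>R frechet_derivative f (at (g x)) b"
  have der: "((\<lambda>x. f (g x)) has_derivative ?f' x) (at x)" if "x \<in> U" for x
  proof -
    have f: "(f has_derivative frechet_derivative f (at (g x))) (at (g x))"
      and g: "(g has_derivative frechet_derivative g (at x)) (at x)"
      by (rule C_k_on_has_derivative[OF Suc.prems(1) assms(2)],
          use Suc.prems(3) that in auto)
        (rule C_k_on_has_derivative[OF Suc.prems(2) assms(1) that])
    have "frechet_derivative f (at (g x)) (frechet_derivative g (at x) v) = ?f' x v" for v
      using has_derivative_linear[OF f]
      by (subst euclidean_representation[symmetric, of "frechet_derivative g (at x) v"])
        (simp only: linear_sum linear_scale)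
    with has_derivative_compose[OF g f] show ?thesis by (simp only:)
  qed
  have "\<And>v. C_k_on k (\<lambda>x. ?f' x v) U"
    using Suc.prems C_k_on_SucD[OF Suc.prems(2)] assms(1)
    by (intro C_k_on_sum C_k_on_scaleR C_k_on_bilinear[OF bounded_bilinear_inner] C_k_on_const
        Suc.IH[where f = "\<lambda>y. frechet_derivative f (at y) _"]) auto
  with der show ?case
    by (rule C_k_on_SucI[OF assms(1)])
qed

section \<open>A global implicit function theorem for a scalar equation\<close>

text \<open>Injectivity in \<open>t\<close> makes the root globally unique, so \<open>T\<close>
  needs no localisation. Its derivative is a formula in \<open>T\<close> itself and the derivatives
  of \<open>F\<close>, so each order of smoothness of \<open>T\<close> yields the next.\<close>

lemma implicit_function_smooth:
  fixes F :: "real \<times> 'a::euclidean_space \<Rightarrow> real"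
  assumes "open P" and smooth: "\<And>k. C_k_on k F P"
    and pos: "\<And>p. p \<in> P \<Longrightarrow> frechet_derivative F (at p) (1, 0) > 0"
    and inj: "\<And>t t' x. (t, x) \<in> P \<Longrightarrow> (t', x) \<in> P \<Longrightarrow> F (t, x) = F (t', x) \<Longrightarrow> t = t'"
    and W: "W = {x. \<exists>t. (t, x) \<in> P \<and> F (t, x) = 0}"
    and T: "\<And>x. x \<in> W \<Longrightarrow> (T x, x) \<in> P \<and> F (T x, x) = 0"
  shows "open W" "C_k_on k T W"
proof -
  \<comment> \<open>Flattening map: it is open by invariance of domain, its inverse is differentiable pointwise,
    and restricts to the implicit function on the slice \<open>F = 0\<close>.\<close>
  define M where "M p = (F p, snd p)" for p
  define N where "N = inv_into P M"
  have injM: "inj_on M P"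
    using inj by (auto simp: inj_on_def M_def)
  have contM: "continuous_on P M"
    using smooth[of 0] unfolding M_def by (auto intro!: continuous_intros)
  have "open (M ` P)"
    using invariance_of_domain[OF contM \<open>open P\<close> injM] .
  moreover have "W = (\<lambda>x. (0, x)) -` (M ` P)"
    by (force simp: W M_def)
  ultimately show "open W"
    by (auto intro!: open_vimage continuous_intros)
  have MT: "M (T x, x) = (0, x)" and TP: "(T x, x) \<in> P" if "x \<in> W" for x
    using T[OF that] by (auto simp: M_def)
  have NT: "fst (N (0, x)) = T x" if "x \<in> W" for x
    using inv_into_f_f[OF injM TP[OF that]] by (simp add: N_def MT[OF that])
  let ?D = "\<lambda>x. frechet_derivative F (at (T x, x))"
  \<comment> \<open>The usual quotient \<open>- F_v / F_t\<close>, with the reciprocal written as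
    \<open>powr (- 1)\<close> to match the closure rules for \<open>C_k_on\<close>.\<close>
  have der: "(T has_derivative (\<lambda>v. (- 1) * (?D x (0, v) * ?D x (1, 0) powr (- 1)))) (at x)"
    if x: "x \<in> W" for x
  proof -
    have DF: "(F has_derivative ?D x) (at (T x, x))"
      using C_k_on_has_derivative[OF smooth \<open>open P\<close> TP[OF x]] .
    define a where "a = ?D x (1, 0)"
    have "a > 0" using pos[OF TP[OF x]] by (simp add: a_def)
    interpret D: linear "?D x" using has_derivative_linear[OF DF] .
    \<comment> \<open>The inverse of the derivative of \<open>M\<close>: since
      \<open>?D x (c, v) = c * a + ?D x (0, v)\<close>, the coordinate \<open>c\<close> is recovered
      by dividing by \<open>a\<close>.\<close>
    let ?N' = "\<lambda>d. ((fst d - ?D x (0, snd d)) / a, snd d)"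
    have split: "?D x (c, v) = c * a + ?D x (0, v)" for c v
      using D.add[of "c *\<^sub>R (1, 0)" "(0, v)"] D.scale[of c "(1, 0)"] by (simp add: a_def)
    have "(\<lambda>d. (?D x d, snd d)) \<circ> ?N' = id"
      using \<open>a > 0\<close> by (auto simp: fun_eq_iff split[of "_ / a"])
    moreover have "(M has_derivative (\<lambda>d. (?D x d, snd d))) (at (T x, x))"
      unfolding M_def by (intro derivative_intros DF)
    moreover have "N (M p) = p" if "p \<in> P" for p
      using inv_into_f_f[OF injM that] by (simp add: N_def)
    ultimately have "(N has_derivative ?N') (at (M (T x, x)))"
      by (intro has_derivative_inverse_strong[OF \<open>open P\<close> TP[OF x] contM])
    then have N': "(N has_derivative ?N') (at (0, x))" by (simp add: MT[OF x])
    have "((\<lambda>x. (0::real, x)) has_derivative (\<lambda>v. (0, v))) (at x)"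
      by (intro derivative_intros)
    from has_derivative_fst[OF has_derivative_compose[OF this N']]
    have "((\<lambda>x. fst (N (0, x))) has_derivative (\<lambda>v. fst (?N' (0, v)))) (at x)" .
    then have "(T has_derivative (\<lambda>v. fst (?N' (0, v)))) (at x)"
      by (rule has_derivative_transform_within_open[OF _ \<open>open W\<close> x NT])
    moreover have "fst (?N' (0, v)) = (- 1) * (?D x (0, v) * ?D x (1, 0) powr (- 1))" for v
      using \<open>a > 0\<close> by (simp add: a_def[symmetric] powr_minus divide_inverse)
    ultimately show ?thesis by (simp only:)
  qed
  show "C_k_on k T W"
  proof (induction k)
    case 0
    have "isCont T x" if "x \<in> W" for x
      using has_derivative_continuous[OF der[OF that]] .
    then show ?case by (auto intro: continuous_at_imp_continuous_on)
  next
    case (Suc k)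
    have "C_k_on k (\<lambda>p. frechet_derivative F (at p) v) P" for v
      using smooth[of "Suc k"] unfolding C_k_on.simps by blast
    moreover have "C_k_on k (\<lambda>x. (T x, x)) W"
      by (intro C_k_on_Pair Suc.IH C_k_on_linear \<open>open W\<close> bounded_linear_ident)
    moreover have "(\<lambda>x. (T x, x)) ` W \<subseteq> P"
      using TP by auto
    ultimately have "C_k_on k (\<lambda>x. ?D x v) W" for v
      by (rule C_k_on_compose[OF \<open>open W\<close> \<open>open P\<close>])
    then show ?case
      by (intro C_k_on_SucI[OF \<open>open W\<close> der] C_k_on_mult C_k_on_const C_k_on_powr \<open>open W\<close>
          pos TP)
  qed
qed

section \<open>Monotonicity of the scalar equation\<close>

definition one_minus_speed :: "real \<Rightarrow> real \<Rightarrow> real \<Rightarrow> real \<Rightarrow> real" where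
  "one_minus_speed K \<gamma> y t = t - K * y\<^sup>2 * t powr \<gamma> * (1 - t)"

lemma one_minus_speed_deriv:
  assumes "t > 0"
  shows "(one_minus_speed K \<gamma> y has_real_derivative
    1 - \<gamma> * (K * y\<^sup>2 * t powr (\<gamma> - 1)) + (\<gamma> + 1) * (K * y\<^sup>2 * t powr (\<gamma> - 1)) * t) (at t)"
proof -
  have "t powr \<gamma> = t powr (\<gamma> - 1) * t"
    using assms by (simp add: powr_diff)
  then show ?thesis
    unfolding one_minus_speed_def using assms
    by (auto intro!: derivative_eq_intros simp: algebra_simps)
qed

text \<open>The last term is strictly positive unless \<open>y = 0\<close>, where the derivative is
  1. The causality bound may therefore be weak, which admits the limiting case
  \<open>\<gamma> k = 1\<close>.\<close>

lemma one_minus_speed_deriv_pos: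
  fixes t K \<gamma> y :: real
  assumes "t > 0" "K > 0" "\<gamma> > 1" "\<gamma> * (K * y\<^sup>2 * t powr (\<gamma> - 1)) \<le> 1"
  shows "1 - \<gamma> * (K * y\<^sup>2 * t powr (\<gamma> - 1)) + (\<gamma> + 1) * (K * y\<^sup>2 * t powr (\<gamma> - 1)) * t > 0"
proof (cases "y = 0")
  case False
  then have "(\<gamma> + 1) * (K * y\<^sup>2 * t powr (\<gamma> - 1)) * t > 0"
    using assms(1-3) by simp
  then show ?thesis using assms(4) by linarith
qed auto

text \<open>As \<open>k\<close> increases with \<open>t\<close>, the causality bound at the right
  endpoint holds on the whole interval.\<close>

lemma one_minus_speed_strict_mono:
  assumes "0 < t" "t < t'" "K > 0" "\<gamma> > 1" "\<gamma> * (K * y\<^sup>2 * t' powr (\<gamma> - 1)) \<le> 1"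
  shows "one_minus_speed K \<gamma> y t < one_minus_speed K \<gamma> y t'"
proof (rule DERIV_pos_imp_increasing[OF assms(2)])
  fix r assume r: "t \<le> r" "r \<le> t'"
  then have "r powr (\<gamma> - 1) \<le> t' powr (\<gamma> - 1)"
    using assms by (intro powr_mono2) auto
  then have "\<gamma> * (K * y\<^sup>2 * r powr (\<gamma> - 1)) \<le> \<gamma> * (K * y\<^sup>2 * t' powr (\<gamma> - 1))"
    using assms by (intro mult_left_mono) auto
  with assms r show "\<exists>d. (one_minus_speed K \<gamma> y has_real_derivative d) (at r) \<and> 0 < d"
    using one_minus_speed_deriv one_minus_speed_deriv_pos[of r K \<gamma> y]
    by (smt (verit))
qed

section \<open>Algebraic inversion of \<open>Phi\<close> for a given root \<open>t\<close>\<close>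

lemma C_k_on_h_sq: "C_k_on k (h_sq h) U" if "open U"
  unfolding h_sq_def
  by (intro C_k_on_sum C_k_on_mult C_k_on_const C_k_on_linear[OF bounded_linear_vec_nth] that)

lemma C_k_on_h_sq_comp:
  assumes "open U" "C_k_on k f U"
  shows "C_k_on k (\<lambda>x. h_sq h (f x)) U"
  using C_k_on_compose[OF assms(1) open_UNIV C_k_on_h_sq assms(2)] by simp

lemma h_sq_scaleR: "h_sq h (c *\<^sub>R u) = c\<^sup>2 * h_sq h u"
  by (simp add: h_sq_def sum_distrib_left power2_eq_square mult_ac)

lemma h_sq_nonneg:
  assumes "\<And>u. u \<noteq> 0 \<Longrightarrow> h_sq h u > 0"
  shows "h_sq h u \<ge> 0"
  by (cases "u = 0") (use assms in \<open>auto simp: h_sq_def less_imp_le\<close>)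

lemma Phi_eq:
  "Phi K \<gamma> h (w, u) =
    (w * (1 + (1 + K * w\<^sup>2) * h_sq h u) powr ((\<gamma> - 1) / 2),
     ((1 + K * w\<^sup>2) * sqrt (1 + h_sq h u) / (1 + (1 + K * w\<^sup>2) * h_sq h u)) *\<^sub>R u)"
  by (simp add: Phi_def vec_eq_iff)

text \<open>The candidate inverse with the root \<open>t\<close> left as a parameter, so that the
  algebra is separated from solving for \<open>t\<close>.\<close>

definition Psi :: "real \<Rightarrow> real \<Rightarrow> real \<Rightarrow> real \<times> (real^3) \<Rightarrow> real \<times> (real^3)" where
  "Psi K \<gamma> t = (\<lambda>(y, v). let k = K * y\<^sup>2 * t powr (\<gamma> - 1) in
     (y * t powr ((\<gamma> - 1) / 2), (t * (1 + k) * (1 + k * t)) powr (- 1 / 2) *\<^sub>R v))"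

lemma powr_half_square: "x > 0 \<Longrightarrow> (x powr (p / 2))\<^sup>2 = x powr p" for x :: real
  by (simp add: power2_eq_square flip: powr_add)

lemma powr_minus_half_square: "x > 0 \<Longrightarrow> (x powr (- 1 / 2))\<^sup>2 = 1 / x" for x :: real
  by (subst powr_half_square) (auto simp: powr_minus_divide)

lemma square_powr_minus_half: "c > 0 \<Longrightarrow> (c\<^sup>2) powr (- 1 / 2) * c = 1" for c :: real
  by (simp add: powr_minus powr_half_sqrt)

lemma one_minus_speed_alt:
  "t > 0 \<Longrightarrow> one_minus_speed K \<gamma> y t = t - (K * y\<^sup>2 * t powr (\<gamma> - 1)) * t * (1 - t)"
  by (simp add: one_minus_speed_def powr_diff)

text \<open>With \<open>t = 1 / D\<close>, the powers of \<open>D\<close> in \<open>y\<close> cancel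
  to give \<open>k\<close>. The scalar equation is then a rational identity in
  \<open>a = 1 + k\<close> and \<open>q = |u|^2\<close>, where \<open>D = 1 + a q\<close>.\<close>

lemma Phi_imp_equation:
  assumes "K > 0" "h_sq h u \<ge> 0" and Phi: "Phi K \<gamma> h (w, u) = (y, v)"
    and D: "D = 1 + (1 + K * w\<^sup>2) * h_sq h u"
  shows "K * y\<^sup>2 * (1 / D) powr (\<gamma> - 1) = K * w\<^sup>2" (is ?k)
    and "one_minus_speed K \<gamma> y (1 / D) = 1 - h_sq h v" (is ?eq)
    and "Psi K \<gamma> (1 / D) (y, v) = (w, u)" (is ?inv)
proof -
  define a q where "a = 1 + K * w\<^sup>2" and "q = h_sq h u"
  have "a \<ge> 1" "q \<ge> 0" using assms by (auto simp: a_def q_def)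
  then have "D \<ge> 1" by (simp add: D flip: a_def q_def)
  have y: "y = w * D powr ((\<gamma> - 1) / 2)" and v: "v = (a * sqrt (1 + q) / D) *\<^sub>R u"
    using Phi by (auto simp: Phi_eq D a_def q_def)
  show k: ?k
    using \<open>D \<ge> 1\<close> by (simp add: y power_mult_distrib powr_half_square powr_divide)
  have "h_sq h v = a\<^sup>2 * (1 + q) * q / D\<^sup>2"
    using \<open>q \<ge> 0\<close> by (simp add: v h_sq_scaleR power_mult_distrib power_divide flip: q_def)
  moreover have "1 / D - (a - 1) * (1 / D) * (1 - 1 / D) = 1 - a\<^sup>2 * (1 + q) * q / D\<^sup>2"
    using \<open>D \<ge> 1\<close> unfolding D a_def[symmetric] q_def[symmetric]
    by (simp add: divide_simps) (simp add: algebra_simps power2_eq_square)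
  ultimately show ?eq
    using \<open>D \<ge> 1\<close> by (simp add: one_minus_speed_alt k) (simp add: a_def)
  \<comment> \<open>The base of the power in \<open>Psi\<close> is the square of the factor by which
    \<open>Phi\<close> scales \<open>u\<close>, so the two scalings cancel.\<close>
  have "1 / D * (1 + K * w\<^sup>2) * (1 + K * w\<^sup>2 * (1 / D)) = (a * sqrt (1 + q) / D)\<^sup>2"
    using \<open>D \<ge> 1\<close> \<open>q \<ge> 0\<close> unfolding D a_def[symmetric] q_def[symmetric]
    by (simp add: power_mult_distrib power_divide divide_simps)
      (simp add: a_def algebra_simps power2_eq_square)
  moreover have "a * sqrt (1 + q) / D > 0"
    using \<open>D \<ge> 1\<close> \<open>q \<ge> 0\<close> \<open>a \<ge> 1\<close> by simp
  ultimately have "(1 / D * (1 + K * w\<^sup>2) * (1 + K * w\<^sup>2 * (1 / D))) powr (- 1 / 2)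
      * (a * sqrt (1 + q) / D) = 1"
    by (simp only: square_powr_minus_half)
  moreover have "D powr ((\<gamma> - 1) / 2) * (1 / D) powr ((\<gamma> - 1) / 2) = 1"
    using \<open>D \<ge> 1\<close> by (simp add: powr_divide)
  ultimately show ?inv
    unfolding Psi_def Let_def split k by (simp add: y v mult.assoc)
qed

text \<open>The equation factors as \<open>|v|^2 = (1 - t) (1 + k t)\<close>. Hence
  \<open>|u|^2 = (1 - t) / (t (1 + k))\<close>, and the denominator in \<open>Phi\<close> is
  \<open>1 / t\<close>. The second conclusion carries the causality condition over to
  \<open>w\<close>.\<close>

lemma equation_imp_Phi:
  assumes "K > 0" "t > 0" "h_sq h v \<ge> 0" and eq: "one_minus_speed K \<gamma> y t = 1 - h_sq h v"
  shows "Phi K \<gamma> h (Psi K \<gamma> t (y, v)) = (y, v)"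
    and "K * (fst (Psi K \<gamma> t (y, v)))\<^sup>2 = K * y\<^sup>2 * t powr (\<gamma> - 1)"
    and "t \<le> 1"
proof -
  define k where "k = K * y\<^sup>2 * t powr (\<gamma> - 1)"
  define w where "w = y * t powr ((\<gamma> - 1) / 2)"
  define m where "m = t * (1 + k) * (1 + k * t)"
  define u where "u = m powr (- 1 / 2) *\<^sub>R v"
  have Psi: "Psi K \<gamma> t (y, v) = (w, u)"
    by (simp add: Psi_def Let_def w_def u_def m_def k_def)
  have "k \<ge> 0" using assms by (simp add: k_def)
  have "m > 0" using \<open>k \<ge> 0\<close> \<open>t > 0\<close> by (simp add: m_def add_pos_nonneg)
  have "h_sq h v = 1 - (t - k * t * (1 - t))"
    using eq one_minus_speed_alt[OF \<open>t > 0\<close>, of K \<gamma> y] unfolding k_def by linarith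
  also have "\<dots> = (1 - t) * (1 + k * t)" by (simp add: algebra_simps)
  finally have A: "h_sq h v = (1 - t) * (1 + k * t)" .
  moreover have "1 + k * t > 0" using \<open>k \<ge> 0\<close> \<open>t > 0\<close> by (simp add: add_pos_nonneg)
  ultimately show "t \<le> 1" using assms(3) by (simp add: zero_le_mult_iff)
  have w2: "K * w\<^sup>2 = k"
    using \<open>t > 0\<close> by (simp add: w_def k_def power_mult_distrib powr_half_square)
  then show "K * (fst (Psi K \<gamma> t (y, v)))\<^sup>2 = K * y\<^sup>2 * t powr (\<gamma> - 1)"
    by (simp add: Psi k_def)
  have "h_sq h u = (1 - t) * (1 + k * t) / m"
    using powr_minus_half_square[OF \<open>m > 0\<close>] by (simp add: u_def h_sq_scaleR A)
  also have "\<dots> = (1 - t) / (t * (1 + k))"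
    using \<open>1 + k * t > 0\<close> by (simp add: m_def)
  finally have q: "h_sq h u = (1 - t) / (t * (1 + k))" .
  have D: "1 + (1 + k) * h_sq h u = 1 / t"
    using \<open>k \<ge> 0\<close> \<open>t > 0\<close> unfolding q by (simp add: divide_simps)
  have "1 + h_sq h u = m / (t * (1 + k))\<^sup>2"
    using \<open>k \<ge> 0\<close> \<open>t > 0\<close> unfolding q m_def
    by (simp add: divide_simps) (simp add: algebra_simps power2_eq_square)
  then have "(1 + k) * sqrt (1 + h_sq h u) / (1 / t) = sqrt m"
    using \<open>k \<ge> 0\<close> \<open>t > 0\<close> by (simp add: real_sqrt_divide)
  then show "Phi K \<gamma> h (Psi K \<gamma> t (y, v)) = (y, v)"
    using \<open>t > 0\<close> \<open>m > 0\<close> unfolding Psi Phi_eq w2 D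
    by (simp add: w_def u_def powr_divide powr_minus powr_half_sqrt)
qed

section \<open>The boundary of the image\<close>

text \<open>The positive root \<open>t\<close> of the scalar equation with \<open>\<gamma> k = 1\<close> and \<open>A = |v|\<^sup>2\<close>.\<close>

definition bdry_root :: "real \<Rightarrow> real \<Rightarrow> real" where
  "bdry_root \<gamma> A = (sqrt ((\<gamma> - 1)\<^sup>2 + 4 * \<gamma> * (1 - A)) - (\<gamma> - 1)) / 2"

text \<open>The discriminant lies above \<open>(\<gamma> - 1)^2\<close> and at most at
  \<open>(\<gamma> + 1)^2\<close>, which bounds the root. Squaring \<open>2 r + \<gamma> - 1\<close>
  gives \<open>r^2 + (\<gamma> - 1) r = \<gamma> (1 - A)\<close>, the equation with
  \<open>k = 1 / \<gamma>\<close>.\<close>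

lemma bdry_root:
  assumes "\<gamma> > 1" "0 \<le> A" "A < 1"
  shows "bdry_root \<gamma> A > 0" "bdry_root \<gamma> A \<le> 1"
    and "bdry_root \<gamma> A - 1 / \<gamma> * bdry_root \<gamma> A * (1 - bdry_root \<gamma> A) = 1 - A"
proof -
  let ?r = "bdry_root \<gamma> A" and ?d = "(\<gamma> - 1)\<^sup>2 + 4 * \<gamma> * (1 - A)"
  have "?d > (\<gamma> - 1)\<^sup>2" using assms by simp
  then have "sqrt ?d > \<gamma> - 1" using real_less_rsqrt by blast
  then show "?r > 0" by (simp add: bdry_root_def)
  have "4 * \<gamma> * (1 - A) \<le> 4 * \<gamma>" using assms by simp
  then have "?d \<le> (\<gamma> + 1)\<^sup>2" by (simp add: power2_eq_square algebra_simps)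
  then have "sqrt ?d \<le> \<gamma> + 1" using assms by (intro real_le_lsqrt) auto
  then show "?r \<le> 1" by (simp add: bdry_root_def)
  have "2 * ?r + (\<gamma> - 1) = sqrt ?d" by (simp add: bdry_root_def field_simps)
  then have "(2 * ?r + (\<gamma> - 1))\<^sup>2 = ?d"
    using real_sqrt_pow2[of ?d] assms by simp
  then have "\<gamma> * ?r - ?r * (1 - ?r) = \<gamma> * (1 - A)"
    by (simp add: power2_eq_square algebra_simps)
  then show "?r - 1 / \<gamma> * ?r * (1 - ?r) = 1 - A"
    using assms(1) by (simp add: field_simps)
qed

text \<open>\<open>y\<close> recovered from \<open>w = (\<gamma> K)\<^bsup>-1/2\<^esup>\<close> and \<open>y = w t\<^bsup>-(\<gamma>-1)/2\<^esup>\<close>.\<close>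

definition bdry :: "real \<Rightarrow> real \<Rightarrow> real \<Rightarrow> real" where
  "bdry K \<gamma> \<nu> = (\<gamma> * K) powr (- 1 / 2) * bdry_root \<gamma> (\<nu>\<^sup>2) powr ((1 - \<gamma>) / 2)"

text \<open>At \<open>y = bdry K \<gamma> (sqrt A)\<close> the boundary root has
  \<open>\<gamma> k = 1\<close>, and for fixed \<open>t\<close> the quantity \<open>k\<close> grows
  with \<open>y^2\<close>.\<close>

lemma less_bdry_iff:
  assumes "K > 0" "\<gamma> > 1" "0 \<le> A" "A < 1" "y \<ge> 0"
  shows "y < bdry K \<gamma> (sqrt A) \<longleftrightarrow> \<gamma> * (K * y\<^sup>2 * bdry_root \<gamma> A powr (\<gamma> - 1)) < 1"
proof -
  let ?r = "bdry_root \<gamma> A" and ?s = "bdry K \<gamma> (sqrt A)"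
  have r: "?r > 0" using bdry_root assms by blast
  have s: "?s > 0" using r assms by (simp add: bdry_def)
  have "?s\<^sup>2 = 1 / (\<gamma> * K) * ?r powr (1 - \<gamma>)"
    using powr_minus_half_square[of "\<gamma> * K"] powr_half_square[of ?r "1 - \<gamma>"] r assms(1-3)
    by (simp add: bdry_def power_mult_distrib)
  moreover have "?r powr (1 - \<gamma>) * ?r powr (\<gamma> - 1) = 1"
    using r by (simp flip: powr_add)
  ultimately have s2: "\<gamma> * (K * ?s\<^sup>2 * ?r powr (\<gamma> - 1)) = 1"
    using assms by (simp add: mult.assoc)
  have "y < ?s \<longleftrightarrow> y\<^sup>2 < ?s\<^sup>2"
    using power_strict_mono[of y ?s 2] power2_less_imp_less[of y ?s] s assms(5) by auto
  also have "\<dots> \<longleftrightarrow> \<gamma> * (K * y\<^sup>2 * ?r powr (\<gamma> - 1)) < \<gamma> * (K * ?s\<^sup>2 * ?r powr (\<gamma> - 1))"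
    using r assms by simp
  finally show ?thesis by (simp add: s2)
qed

text \<open>This identifies the region under the graph of \<open>bdry\<close> with the solvability
  of the scalar equation under causality. Both directions compare with the limiting root
  \<open>bdry_root \<gamma> A\<close>.\<close>

lemma solvable_iff_less_bdry:
  assumes "K > 0" "\<gamma> > 1" "0 \<le> A" "A < 1" "y \<ge> 0"
  shows "y < bdry K \<gamma> (sqrt A) \<longleftrightarrow>
    (\<exists>t>0. \<gamma> * (K * y\<^sup>2 * t powr (\<gamma> - 1)) < 1 \<and> one_minus_speed K \<gamma> y t = 1 - A)"
proof -
  let ?r = "bdry_root \<gamma> A" and ?k = "\<lambda>t. K * y\<^sup>2 * t powr (\<gamma> - 1)"
  note r = bdry_root[OF assms(2-4)]
  show ?thesis unfolding less_bdry_iff[OF assms]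
  proof
    assume k: "\<gamma> * ?k ?r < 1"
    \<comment> \<open>Since \<open>k\<close> at \<open>?r\<close> is below
      \<open>1 / \<gamma>\<close>, the left-hand side there is at least its limiting value
      \<open>1 - A\<close>; a root then lies in \<open>[0, ?r]\<close>.\<close>
    then have "?k ?r * (?r * (1 - ?r)) \<le> 1 / \<gamma> * (?r * (1 - ?r))"
      using r assms(2) by (intro mult_right_mono) (auto simp: field_simps)
    then have "1 - A \<le> one_minus_speed K \<gamma> y ?r"
      using r by (simp add: one_minus_speed_alt mult.assoc)
    moreover have "one_minus_speed K \<gamma> y 0 \<le> 1 - A"
      using assms by (simp add: one_minus_speed_def)
    moreover have "continuous_on {0..?r} (one_minus_speed K \<gamma> y)"
      unfolding one_minus_speed_def using assms(2)
      by (intro continuous_intros continuous_on_powr') auto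
    ultimately obtain t where t: "0 \<le> t" "t \<le> ?r" "one_minus_speed K \<gamma> y t = 1 - A"
      using IVT'[of "one_minus_speed K \<gamma> y" 0 "1 - A" ?r] r(1) by auto
    \<comment> \<open>At 0 the left-hand side vanishes because \<open>0 powr \<gamma> = 0\<close>,
      while \<open>1 - A > 0\<close>.\<close>
    have "t \<noteq> 0" using t(3) assms(2,4) by (auto simp: one_minus_speed_def)
    then have "t > 0" using t(1) by simp
    have "t powr (\<gamma> - 1) \<le> ?r powr (\<gamma> - 1)"
      using t assms(2) by (intro powr_mono2) auto
    then have "?k t \<le> ?k ?r"
      using assms(1) by (intro mult_left_mono) auto
    then have "\<gamma> * ?k t \<le> \<gamma> * ?k ?r" using assms(2)
      by (simp add: mult_left_mono)
    then have "\<gamma> * ?k t < 1" using k by linarith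
    with \<open>t > 0\<close> t(3) show "\<exists>t>0. \<gamma> * ?k t < 1 \<and> one_minus_speed K \<gamma> y t = 1 - A"
      by blast
  next
    assume "\<exists>t>0. \<gamma> * ?k t < 1 \<and> one_minus_speed K \<gamma> y t = 1 - A"
    then obtain t where t: "t > 0" "\<gamma> * ?k t < 1" "one_minus_speed K \<gamma> y t = 1 - A" by blast
    show "\<gamma> * ?k ?r < 1"
    proof (rule ccontr)
      assume "\<not> \<gamma> * ?k ?r < 1"
      then have kr: "\<gamma> * ?k ?r \<ge> 1" by simp
      then have "y > 0" using assms(5) by (cases "y = 0") auto
      \<comment> \<open>\<open>t'\<close> is where \<open>\<gamma> k\<close> reaches 1: monotonicity in \<open>t\<close> is available only up to there.\<close>
      define c where "c = \<gamma> * (K * y\<^sup>2)"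
      have "c > 0" using \<open>y > 0\<close> assms by (simp add: c_def)
      define t' where "t' = (1 / c) powr (1 / (\<gamma> - 1))"
      have "t' > 0" using \<open>c > 0\<close> by (simp add: t'_def)
      have kc: "\<gamma> * ?k x = c * x powr (\<gamma> - 1)" for x by (simp add: c_def)
      have t'_powr: "t' powr (\<gamma> - 1) = 1 / c"
        using \<open>c > 0\<close> assms(2) by (simp add: t'_def powr_powr)
      then have kt': "\<gamma> * ?k t' = 1" using \<open>c > 0\<close> unfolding kc unfolding t'_powr by simp
      have "t powr (\<gamma> - 1) < t' powr (\<gamma> - 1)" "t' powr (\<gamma> - 1) \<le> ?r powr (\<gamma> - 1)"
        using t(2) kr \<open>c > 0\<close> unfolding kc unfolding t'_powr by (auto simp: field_simps)
      then have "t < t'" "t' \<le> ?r"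
        using t(1) \<open>t' > 0\<close> r(1) assms(2) powr_less_cancel2[of "\<gamma> - 1" t t']
          powr_less_mono2[of "\<gamma> - 1" ?r t'] by (auto simp: not_le[symmetric])
      \<comment> \<open>At \<open>t'\<close> the equation takes its limiting quadratic form, which
        is increasing in \<open>t\<close>; so \<open>t' \<le> ?r\<close> bounds its value by
        \<open>1 - A\<close>.\<close>
      have "?k t' = 1 / \<gamma>" using kt' assms(2) by (simp add: field_simps)
      then have "one_minus_speed K \<gamma> y t' = t' - 1 / \<gamma> * t' * (1 - t')"
        by (simp only: one_minus_speed_alt[OF \<open>t' > 0\<close>])
      then have "\<gamma> * one_minus_speed K \<gamma> y t' = \<gamma> * t' - t' * (1 - t')"
        using assms(2) by (simp add: right_diff_distrib)
      also have "\<dots> \<le> \<gamma> * ?r - ?r * (1 - ?r)"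
      proof -
        have "(\<gamma> - 1) * t' \<le> (\<gamma> - 1) * ?r" "t' * t' \<le> ?r * ?r"
          using \<open>t' > 0\<close> \<open>t' \<le> ?r\<close> assms(2) by (auto intro: mult_mono)
        then show ?thesis by (simp add: algebra_simps)
      qed
      also have "\<dots> = \<gamma> * (1 - A)"
        unfolding r(3)[symmetric] using assms(2) by (simp add: right_diff_distrib)
      finally have "one_minus_speed K \<gamma> y t' \<le> 1 - A" using assms(2) by simp
      moreover have "one_minus_speed K \<gamma> y t < one_minus_speed K \<gamma> y t'"
        using one_minus_speed_strict_mono[OF t(1) \<open>t < t'\<close>] assms kt' by simp
      ultimately show False using t(3) by simp
    qed
  qed
qed

section \<open>Smoothness of \<open>Phi\<close> and of its inverse\<close>

lemma less_powr_minus_half_iff: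
  fixes c w :: real
  assumes "c > 0" "w \<ge> 0"
  shows "w < c powr (- 1 / 2) \<longleftrightarrow> c * w\<^sup>2 < 1"
proof -
  let ?s = "c powr (- 1 / 2)"
  have "w < ?s \<longleftrightarrow> w\<^sup>2 < ?s\<^sup>2"
    using power_strict_mono[of w ?s 2] power2_less_imp_less[of w ?s] assms by auto
  also have "?s\<^sup>2 = 1 / c"
    using powr_minus_half_square assms(1) .
  also have "w\<^sup>2 < 1 / c \<longleftrightarrow> c * w\<^sup>2 < 1"
    using assms(1) by (simp add: field_simps)
  finally show ?thesis .
qed

text \<open>Written with powers of positive bases, the formula is smooth on the whole space, so one
  global extension serves every \<open>S\<close>.\<close>

lemma smooth_on_Phi:
  assumes "K > 0" "\<And>u. h_sq h u \<ge> 0"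
  shows "smooth_on (Phi K \<gamma> h) S"
proof -
  have "C_k_on k (\<lambda>x. (fst x * (1 + (1 + K * (fst x)\<^sup>2) * h_sq h (snd x)) powr ((\<gamma> - 1) / 2),
     ((1 + K * (fst x)\<^sup>2) * (1 + h_sq h (snd x)) powr (1 / 2)
       * (1 + (1 + K * (fst x)\<^sup>2) * h_sq h (snd x)) powr (- 1)) *\<^sub>R snd x)) UNIV" for k
    using assms
    by (intro C_k_on_Pair C_k_on_mult C_k_on_scaleR C_k_on_powr C_k_on_add C_k_on_power
        C_k_on_const C_k_on_h_sq_comp C_k_on_linear bounded_linear_fst bounded_linear_snd open_UNIV)
      (auto intro!: add_pos_nonneg mult_nonneg_nonneg)
  moreover have "Phi K \<gamma> h x = (fst x * (1 + (1 + K * (fst x)\<^sup>2) * h_sq h (snd x)) powr ((\<gamma> - 1) / 2),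
     ((1 + K * (fst x)\<^sup>2) * (1 + h_sq h (snd x)) powr (1 / 2)
       * (1 + (1 + K * (fst x)\<^sup>2) * h_sq h (snd x)) powr (- 1)) *\<^sub>R snd x)" for x
  proof -
    have "1 + (1 + K * (fst x)\<^sup>2) * h_sq h (snd x) > 0" "1 + h_sq h (snd x) > 0"
      using assms by (auto intro!: add_pos_nonneg mult_nonneg_nonneg)
    then show ?thesis
      by (cases x) (simp add: Phi_eq powr_half_sqrt powr_minus_divide)
  qed
  ultimately have "\<forall>k. C_k_on k (Phi K \<gamma> h) UNIV"
    by presburger
  then show ?thesis unfolding smooth_on_def by (metis open_UNIV UNIV_I)
qed

theorem theorem4p1:
  fixes K \<gamma> :: real and h :: "real^3^3"
  assumes "K > 0" and "\<gamma> > 1"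
    and "\<And>a b. h $ a $ b = h $ b $ a"
    and "\<And>u. u \<noteq> 0 \<Longrightarrow> h_sq h u > 0"
  shows "\<exists>s :: real \<Rightarrow> real.
    diffeomorphism_onto (Phi K \<gamma> h) ({0..<(\<gamma> * K) powr (- 1 / 2)} \<times> UNIV) (Omega h s)"
proof
  note pos = assms(1,2)
  have h0: "h_sq h u \<ge> 0" for u
    using h_sq_nonneg assms(4) .
  define F :: "real \<times> real \<times> (real^3) \<Rightarrow> real" where
    "F p = fst p - K * (fst (snd p))\<^sup>2 * fst p powr \<gamma> * (1 - fst p) - 1
      + h_sq h (snd (snd p))" for p
  define P :: "(real \<times> real \<times> (real^3)) set" where
    "P = {p. fst p > 0 \<and> \<gamma> * (K * (fst (snd p))\<^sup>2 * fst p powr (\<gamma> - 1)) < 1}"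
  \<comment> \<open>No sign is imposed on \<open>y\<close>, so \<open>W\<close> extends across
    \<open>y = 0\<close> and can serve as an open neighbourhood of the image.\<close>
  define W where "W = {x. \<exists>t. (t, x) \<in> P \<and> F (t, x) = 0}"
  define T where "T x = (SOME t. (t, x) \<in> P \<and> F (t, x) = 0)" for x
  define g where "g x = Psi K \<gamma> (T x) x" for x
  let ?S = "{0..<(\<gamma> * K) powr (- 1 / 2)} \<times> (UNIV :: (real^3) set)"
  \<comment> \<open>The witness for \<open>s\<close> is \<open>bdry K \<gamma>\<close>.\<close>
  let ?O = "Omega h (bdry K \<gamma>)"

  have P_iff: "(t, y, v) \<in> P \<longleftrightarrow> t > 0 \<and> \<gamma> * (K * y\<^sup>2 * t powr (\<gamma> - 1)) < 1" for t y v
    by (simp add: P_def)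
  have F_eq: "F (t, y, v) = one_minus_speed K \<gamma> y t - (1 - h_sq h v)" for t y v
    by (simp add: F_def one_minus_speed_def)
  have "open ({p. fst p > 0} \<inter> (\<lambda>p::real \<times> real \<times> (real^3).
      \<gamma> * (K * (fst (snd p))\<^sup>2 * fst p powr (\<gamma> - 1))) -` {..<1})"
    by (intro continuous_open_preimage continuous_intros open_Collect_less) auto
  also have "{p. fst p > 0} \<inter> (\<lambda>p. \<gamma> * (K * (fst (snd p))\<^sup>2 * fst p powr (\<gamma> - 1))) -` {..<1} = P"
    by (auto simp: P_def)
  finally have "open P" .
  have smoothF: "C_k_on k F P" for k
    unfolding F_def[abs_def] using \<open>open P\<close>
    by (intro C_k_on_diff C_k_on_mult C_k_on_powr C_k_on_add C_k_on_power C_k_on_const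
        C_k_on_h_sq_comp C_k_on_linear bounded_linear_fst
        bounded_linear_compose[OF bounded_linear_fst bounded_linear_snd]
        bounded_linear_compose[OF bounded_linear_snd bounded_linear_snd])
      (auto simp: P_def)
  have posF: "frechet_derivative F (at p) (1, 0) > 0" if "p \<in> P" for p
  proof -
    obtain t y v where p: "p = (t, y, v)" by (cases p)
    let ?D = "frechet_derivative F (at p)"
    let ?d = "1 - \<gamma> * (K * y\<^sup>2 * t powr (\<gamma> - 1)) + (\<gamma> + 1) * (K * y\<^sup>2 * t powr (\<gamma> - 1)) * t"
    have "t > 0" "\<gamma> * (K * y\<^sup>2 * t powr (\<gamma> - 1)) < 1"
      using that by (auto simp: p P_iff)
    then have "?d > 0" using pos by (intro one_minus_speed_deriv_pos) auto
    \<comment> \<open>\<open>F\<close> is restricted to the line in the \<open>t\<close> direction;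
      uniqueness of derivatives identifies \<open>?D (1, 0)\<close> with the explicit
      \<open>?d\<close>.\<close>
    have "((\<lambda>s. (s, y, v)) has_derivative (\<lambda>s. (s, 0))) (at t)"
      by (auto intro!: derivative_eq_intros simp: zero_prod_def)
    moreover have "(F has_derivative ?D) (at (t, y, v))"
      using C_k_on_has_derivative[OF smoothF \<open>open P\<close> that] by (simp add: p)
    ultimately have "((\<lambda>s. F (s, y, v)) has_derivative (\<lambda>s. ?D (s, 0))) (at t)"
      by (rule has_derivative_compose)
    moreover have "((\<lambda>s. F (s, y, v)) has_real_derivative ?d) (at t)"
      unfolding F_eq using one_minus_speed_deriv[OF \<open>t > 0\<close>] by (auto intro!: derivative_eq_intros)
    ultimately have "(\<lambda>s. ?D (s, 0)) = (*) ?d"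
      unfolding has_field_derivative_def by (rule has_derivative_unique)
    from fun_cong[OF this, of 1] have "?D (1, 0) = ?d" by simp
    with \<open>?d > 0\<close> show ?thesis by simp
  qed
  have inj: "t = t'" if "(t, x) \<in> P" "(t', x) \<in> P" "F (t, x) = F (t', x)" for t t' x
  proof -
    obtain y v where x: "x = (y, v)" by (cases x)
    show ?thesis
      using that one_minus_speed_strict_mono[OF _ _ pos, of t t' y]
        one_minus_speed_strict_mono[OF _ _ pos, of t' t y]
      by (cases t t' rule: linorder_cases) (auto simp: x P_iff F_eq)
  qed
  have T: "(T x, x) \<in> P \<and> F (T x, x) = 0" if "x \<in> W" for x
    using that unfolding W_def T_def mem_Collect_eq by (rule someI_ex)
  have T_eq: "T x = t" if "(t, x) \<in> P" "F (t, x) = 0" for t x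
    using T[of x] inj[of "T x" x t] that by (auto simp: W_def)
  note W = implicit_function_smooth[OF \<open>open P\<close> smoothF posF inj W_def T]

  have Phi_S: "Phi K \<gamma> h x \<in> ?O \<and> g (Phi K \<gamma> h x) = x" if x: "x \<in> ?S" for x
  proof -
    obtain w u where wu: "x = (w, u)" by (cases x)
    obtain y v where yv: "Phi K \<gamma> h (w, u) = (y, v)" by fastforce
    define D where "D = 1 + (1 + K * w\<^sup>2) * h_sq h u"
    note eq = Phi_imp_equation[OF pos(1) h0 yv D_def]
    have "D \<ge> 1" using pos h0 by (simp add: D_def)
    have w: "w \<ge> 0" "\<gamma> * (K * w\<^sup>2) < 1"
      using x less_powr_minus_half_iff[of "\<gamma> * K" w] pos by (auto simp: wu mult.assoc)
    have "y \<ge> 0" using yv w(1) by (auto simp: Phi_eq)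
    \<comment> \<open>\<open>1 / D\<close> is a root satisfying causality, so by uniqueness it is
      the value of \<open>T\<close> at \<open>(y, v)\<close>.\<close>
    have t: "(1 / D, y, v) \<in> P" "F (1 / D, y, v) = 0"
      using \<open>D \<ge> 1\<close> w unfolding P_iff F_eq eq(1,2) by auto
    then have "g (y, v) = (w, u)" by (simp add: g_def T_eq eq(3))
    moreover have "h_sq h v < 1"
    proof -
      \<comment> \<open>Causality and \<open>\<gamma> > 1\<close> give \<open>k < 1\<close>, hence
        \<open>1 - |v|^2 = t (1 - k (1 - t))\<close> is positive.\<close>
      have "K * w\<^sup>2 \<le> \<gamma> * (K * w\<^sup>2)"
        using mult_right_mono[of 1 \<gamma> "K * w\<^sup>2"] pos by simp
      then have "K * w\<^sup>2 * (1 - 1 / D) < 1"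
        using w(2) \<open>D \<ge> 1\<close> pos(1) mult_left_le[of "1 - 1 / D" "K * w\<^sup>2"]
        by (smt (verit) divide_nonneg_nonneg mult_nonneg_nonneg zero_le_power2)
      then have "1 / D * (1 - K * w\<^sup>2 * (1 - 1 / D)) > 0"
        using \<open>D \<ge> 1\<close> by (intro mult_pos_pos) auto
      also have "1 / D * (1 - K * w\<^sup>2 * (1 - 1 / D)) = 1 / D - K * w\<^sup>2 * (1 / D) * (1 - 1 / D)"
        by (simp add: right_diff_distrib)
      also have "\<dots> = 1 - h_sq h v"
        using eq(2) one_minus_speed_alt[of "1 / D" K \<gamma> y] \<open>D \<ge> 1\<close> unfolding eq(1) by simp
      finally show ?thesis by simp
    qed
    moreover have "y < bdry K \<gamma> (sqrt (h_sq h v))"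
      unfolding solvable_iff_less_bdry[OF pos h0 \<open>h_sq h v < 1\<close> \<open>y \<ge> 0\<close>]
      using t by (intro exI[of _ "1 / D"]) (auto simp: P_iff F_eq)
    ultimately show ?thesis using \<open>y \<ge> 0\<close> by (simp add: wu yv Omega_def)
  qed
  have O_W: "?O \<subseteq> W"
  proof
    fix x assume "x \<in> ?O"
    moreover obtain y v where x: "x = (y, v)" by (cases x)
    ultimately have O: "y \<ge> 0" "y < bdry K \<gamma> (sqrt (h_sq h v))" "h_sq h v < 1"
      by (auto simp: Omega_def)
    then show "x \<in> W"
      using solvable_iff_less_bdry[OF pos h0 O(3,1)] by (auto simp: W_def x P_iff F_eq)
  qed
  have g_O: "g x \<in> ?S \<and> Phi K \<gamma> h (g x) = x" if "x \<in> ?O" for x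
  proof -
    obtain y v where x: "x = (y, v)" by (cases x)
    have "(T x, y, v) \<in> P" "F (T x, y, v) = 0" using T O_W that x by auto
    then have t: "T x > 0" "\<gamma> * (K * y\<^sup>2 * T x powr (\<gamma> - 1)) < 1"
        "one_minus_speed K \<gamma> y (T x) = 1 - h_sq h v"
      by (auto simp: P_iff F_eq)
    note eq = equation_imp_Phi[OF pos(1) t(1) h0 t(3)]
    have "y \<ge> 0" using that by (simp add: x Omega_def)
    then have "fst (g x) \<ge> 0" by (simp add: g_def x Psi_def Let_def)
    moreover have "\<gamma> * K * (fst (g x))\<^sup>2 < 1"
      using t(2) unfolding eq(2)[symmetric] by (simp add: g_def x mult.assoc)
    ultimately have "g x \<in> ?S"
      using less_powr_minus_half_iff[of "\<gamma> * K" "fst (g x)"] pos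
      by (auto simp: mem_Times_iff)
    with eq(1) show ?thesis by (simp add: g_def x)
  qed
  have bij: "bij_betw (Phi K \<gamma> h) ?S ?O"
    using Phi_S g_O by (intro bij_betw_byWitness[where f' = g]) blast+
  have inv: "inv_into ?S (Phi K \<gamma> h) x = g x" if "x \<in> ?O" for x
    using g_O[OF that] bij by (intro inv_into_f_eq) (auto simp: bij_betw_def)
  have "C_k_on k g W" for k
  proof -
    \<comment> \<open>These are the positive bases required for powers; they stay positive for
      negative \<open>y\<close>, which enters only through its square.\<close>
    have tk: "T x > 0" "1 + K * (fst x)\<^sup>2 * T x powr (\<gamma> - 1) > 0"
      "1 + K * (fst x)\<^sup>2 * T x powr (\<gamma> - 1) * T x > 0" if "x \<in> W" for x
      using T[OF that] pos by (auto simp: P_def intro!: add_pos_nonneg)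
    have "C_k_on k (\<lambda>x. (fst x * T x powr ((\<gamma> - 1) / 2),
        (T x * (1 + K * (fst x)\<^sup>2 * T x powr (\<gamma> - 1))
          * (1 + K * (fst x)\<^sup>2 * T x powr (\<gamma> - 1) * T x)) powr (- 1 / 2) *\<^sub>R snd x)) W"
      by (intro C_k_on_Pair C_k_on_mult C_k_on_scaleR C_k_on_powr C_k_on_add C_k_on_power
          C_k_on_const W C_k_on_linear bounded_linear_fst bounded_linear_snd mult_pos_pos tk)
    then show ?thesis by (simp add: g_def[abs_def] Psi_def Let_def case_prod_unfold)
  qed
  then have "smooth_on (inv_into ?S (Phi K \<gamma> h)) ?O"
    unfolding smooth_on_def using W(1) O_W inv by (intro ballI exI[of _ W] exI[of _ g]) auto
  with bij smooth_on_Phi[OF pos(1) h0]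
  show "diffeomorphism_onto (Phi K \<gamma> h) ?S ?O"
    by (simp add: diffeomorphism_onto_def)
qed

end
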